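(* Let $n\ge1$, $\alpha\in\mathbb{R}\setminus\pi\mathbb{Z}$ and let $f$ be a locally integrable function on $\mathbb{R}^n$. Then $$f\in\mathrm{BMO}_\alpha(\mathbb{R}^n)\quad\Longleftrightarrow\quad M^{\#}_\alpha f\in L^\infty(\mathbb{R}^n).$$ Moreover, there exist constants $c,C>0$ depending only on the dimension $n$ such that $$c\|f\|_{\mathrm{BMO}_\alpha}\le\|M^{\#}_\alpha f\|_{L^\infty}\le C\|f\|_{\mathrm{BMO}_\alpha}.$$
   Context: $M_\alpha f(x)=e^{i\pi|x|^2\cot\alpha}f(x)$. $\mathrm{Avg}_Q(g)=\frac1{|Q|}\int_Qg$ and $\|g\|_{\mathrm{BMO}}:=\sup_Q\frac1{|Q|}\int_Q|g-\mathrm{Avg}_Q(g)|\,dx$, the supremum being over cubes $Q\subset\mathbb{R}^n$. $\mathrm{BMO}_\alpha(\mathbb{R}^n):=\{b\in\mathcal S'(\mathbb{R}^n):M_\alpha b\in\mathrm{BMO}(\mathbb{R}^n)\}$ with $\|b\|_{\mathrm{BMO}_\alpha}:=\|M_\alpha b\|_{\mathrm{BMO}}$. $M^{\#}$ is the classical Fefferman--Stein sharp maximal operator $M^{\#}g(x)=\sup_{Q\ni x}\frac1{|Q|}\int_Q|g(y)-\mathrm{Avg}_Q(g)|\,dy$ (supremum over cubes containing $x$), and $M^{\#}_\alpha f:=M^{\#}(M_\alpha f)$. *)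

theory Defs
  imports "HOL-Analysis.Analysis" "HOL-Probability.Essential_Supremum"
begin

section \<open>Locally integrable functions, cubes and BMO\<close>

definition locally_integrable :: "(real^'n::finite \<Rightarrow> complex) \<Rightarrow> bool" where
  "locally_integrable g \<longleftrightarrow> (\<forall>K. compact K \<longrightarrow> set_integrable lebesgue K g)"

text \<open>Cubes are closed, nondegenerate, with sides parallel to the axes.\<close>

definition cubes :: "(real^'n::finite) set set" where
  "cubes = {cbox a (a + (\<chi> i. l)) | a l. 0 < l}"

definition Avg :: "(real^'n::finite) set \<Rightarrow> (real^'n \<Rightarrow> complex) \<Rightarrow> complex" where
  "Avg Q g = (1 / measure lebesgue Q) *\<^sub>R (LINT y:Q|lebesgue. g y)"

definition mean_osc :: "(real^'n::finite) set \<Rightarrow> (real^'n \<Rightarrow> complex) \<Rightarrow> ennreal" where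
  "mean_osc Q g =
     (\<integral>\<^sup>+ y\<in>Q. ennreal (norm (g y - Avg Q g)) \<partial>lebesgue) / emeasure lebesgue Q"

text \<open>Norms and maximal functions take values in $[0,\infty]$.\<close>

definition bmo_norm :: "(real^'n::finite \<Rightarrow> complex) \<Rightarrow> ennreal" where
  "bmo_norm g = (SUP Q\<in>cubes. mean_osc Q g)"

definition BMO :: "(real^'n::finite \<Rightarrow> complex) set" where
  "BMO = {g. locally_integrable g \<and> bmo_norm g < \<infinity>}"

definition sharp_max :: "(real^'n::finite \<Rightarrow> complex) \<Rightarrow> real^'n \<Rightarrow> ennreal" where
  "sharp_max g x = (SUP Q\<in>{Q\<in>cubes. x \<in> Q}. mean_osc Q g)"

definition L_infinity :: "(real^'n::finite \<Rightarrow> ennreal) set" where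
  "L_infinity = {h. h \<in> borel_measurable lebesgue \<and> esssup lebesgue h < \<infinity>}"


section \<open>Schwartz functions and tempered distributions\<close>

text \<open>A multi-index is encoded as the list of coordinates in which to differentiate; a
  multi-index of order $k$ corresponds to lists of length $k$.\<close>

primrec partials :: "'n list \<Rightarrow> (real^'n::finite \<Rightarrow> complex) \<Rightarrow> real^'n \<Rightarrow> complex" where
  "partials [] \<phi> = \<phi>"
| "partials (i # \<beta>) \<phi> = (\<lambda>x. frechet_derivative (partials \<beta> \<phi>) (at x) (axis i 1))"

definition smooth :: "(real^'n::finite \<Rightarrow> complex) \<Rightarrow> bool" where
  "smooth \<phi> \<longleftrightarrow> (\<forall>\<beta> x. partials \<beta> \<phi> differentiable (at x))"

definition test_functions :: "(real^'n::finite \<Rightarrow> complex) set" where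
  "test_functions = {\<phi>. smooth \<phi> \<and> compact (closure {x. \<phi> x \<noteq> 0})}"

definition schwartz :: "(real^'n::finite \<Rightarrow> complex) set" where
  "schwartz = {\<phi>. smooth \<phi> \<and>
     (\<forall>\<beta> N. bdd_above (range (\<lambda>x. (1 + norm x) ^ N * norm (partials \<beta> \<phi> x))))}"

text \<open>The increasing family of norms generating the topology of the Schwartz space. On Schwartz
  functions the supremum is over a bounded set, as there are finitely many lists of length at
  most \<open>N\<close>.\<close>

definition schwartz_norm :: "nat \<Rightarrow> (real^'n::finite \<Rightarrow> complex) \<Rightarrow> real" where
  "schwartz_norm N \<phi> =
     (SUP (\<beta>, x)\<in>{\<beta>. length \<beta> \<le> N} \<times> UNIV. (1 + norm x) ^ N * norm (partials \<beta> \<phi> x))"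

text \<open>Continuous linear functionals on the Schwartz space. The values of \<open>T\<close> off the Schwartz
  space are irrelevant.\<close>

definition tempered_distributions :: "((real^'n::finite \<Rightarrow> complex) \<Rightarrow> complex) set" where
  "tempered_distributions = {T.
     (\<forall>\<phi>\<in>schwartz. \<forall>\<psi>\<in>schwartz. \<forall>a b.
        T (\<lambda>x. a * \<phi> x + b * \<psi> x) = a * T \<phi> + b * T \<psi>) \<and>
     (\<exists>N C. \<forall>\<phi>\<in>schwartz. norm (T \<phi>) \<le> C * schwartz_norm N \<phi>)}"

text \<open>A function \<open>b\<close> belongs to $\mathcal S'$ if it is locally integrable and the distribution
  $\varphi \mapsto \int b\varphi$ on test functions is (the restriction of) a tempered one.\<close>

definition tempered_function :: "(real^'n::finite \<Rightarrow> complex) \<Rightarrow> bool" where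
  "tempered_function b \<longleftrightarrow> locally_integrable b \<and>
     (\<exists>T\<in>tempered_distributions. \<forall>\<phi>\<in>test_functions. T \<phi> = (LINT x|lebesgue. b x * \<phi> x))"


section \<open>The chirp-modulated space and sharp maximal operator\<close>

definition chirp :: "real \<Rightarrow> (real^'n::finite \<Rightarrow> complex) \<Rightarrow> real^'n \<Rightarrow> complex" where
  "chirp \<alpha> f x = exp (\<i> * of_real (pi * (norm x)\<^sup>2 * cot \<alpha>)) * f x"

text \<open>A tempered distribution \<open>b\<close> whose product with the unimodular smooth function
  $e^{i\pi|x|^2\cot\alpha}$ is a function in BMO is itself a locally integrable function, and the
  product is then pointwise. Hence $\mathrm{BMO}_\alpha$ is a space of functions.\<close>

definition BMO_frac :: "real \<Rightarrow> (real^'n::finite \<Rightarrow> complex) set" where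
  "BMO_frac \<alpha> = {b. tempered_function b \<and> chirp \<alpha> b \<in> BMO}"

definition bmo_frac_norm :: "real \<Rightarrow> (real^'n::finite \<Rightarrow> complex) \<Rightarrow> ennreal" where
  "bmo_frac_norm \<alpha> b = bmo_norm (chirp \<alpha> b)"

definition sharp_max_frac :: "real \<Rightarrow> (real^'n::finite \<Rightarrow> complex) \<Rightarrow> real^'n \<Rightarrow> ennreal" where
  "sharp_max_frac \<alpha> f = sharp_max (chirp \<alpha> f)"

end

theory Submission
  imports Defs
begin

text \<open>
  Both bounds hold with constant 1. The supremum of $M^{\#}g$ over all points is
  $\|g\|_{\mathrm{BMO}}$, and it equals the essential supremum because $M^{\#}g$ is lower
  semicontinuous: the mean oscillation over a cube changes little when the cube is slightly
  enlarged, so a cube through $x$ may be replaced by one containing $x$ in its interior.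

  For the equivalence it remains to see that $M_\alpha f \in \mathrm{BMO}$ makes $f$ tempered.
  The averages of $g = M_\alpha f$ over $[-2^k,2^k]^n$ grow at most linearly in $k$, hence
  $\int |g|\,(1+|x|)^{-n-2}\,dx < \infty$. As $|f| = |g|$, the function $f$ pairs continuously
  with Schwartz functions.
\<close>

section \<open>The essential supremum of the sharp maximal function\<close>

lemma measure_cube:
  fixes a :: "real^'n::finite"
  assumes "0 \<le> l"
  shows "measure lebesgue (cbox a (a + (\<chi> i. l))) = l ^ CARD('n)"
proof -
  have "cbox a (a + (\<chi> i. l)) \<noteq> {}"
    using assms by (simp add: interval_ne_empty_cart)
  then show ?thesis
    by (simp add: content_cbox_cart)
qed

lemma measure_cubes_pos: "Q \<in> cubes \<Longrightarrow> 0 < measure lebesgue Q"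
  unfolding cubes_def by (auto simp: measure_cube simp del: measure_completion)

lemma compact_cubes: "Q \<in> cubes \<Longrightarrow> compact Q"
  unfolding cubes_def by (auto intro: compact_cbox)

lemma sets_cubes: "Q \<in> cubes \<Longrightarrow> Q \<in> sets lebesgue"
  using lmeasurable_compact[OF compact_cubes] by (rule fmeasurableD)

lemma emeasure_cubes: "Q \<in> cubes \<Longrightarrow> emeasure lebesgue Q = ennreal (measure lebesgue Q)"
  using lmeasurable_compact[OF compact_cubes] by (rule emeasure_eq_measure2)

lemma locally_integrable_cubes:
  "locally_integrable g \<Longrightarrow> Q \<in> cubes \<Longrightarrow> set_integrable lebesgue Q g"
  by (simp add: locally_integrable_def compact_cubes)

lemma set_integrable_const_cubes:
  fixes c :: "'a::{banach,second_countable_topology}"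
  assumes "Q \<in> cubes"
  shows "set_integrable lebesgue Q (\<lambda>_. c)"
  unfolding set_integrable_def
  using lmeasurable_compact[OF compact_cubes[OF assms]]
  by (intro integrable_scaleR_left) (rule lmeasurable_iff_integrable[THEN iffD1])

lemma set_integral_const_cubes:
  fixes c :: "'a::{banach,second_countable_topology}"
  assumes "Q \<in> cubes"
  shows "(LINT y:Q|lebesgue. c) = measure lebesgue Q *\<^sub>R c"
  using assms by (intro set_integral_const sets_cubes) (simp_all add: emeasure_cubes del: emeasure_completion)

lemma set_integrable_dist_cubes:
  assumes "locally_integrable g" "Q \<in> cubes"
  shows "set_integrable lebesgue Q (\<lambda>y. norm (g y - c))"
  using assms by (intro set_integrable_norm set_integral_diff locally_integrable_cubes set_integrable_const_cubes)

text \<open>Real-valued counterpart of \<open>mean_osc\<close>, so that limits and estimates can be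
  done with Bochner integrals.\<close>

definition osc :: "(real^'n::finite) set \<Rightarrow> (real^'n \<Rightarrow> complex) \<Rightarrow> real" where
  "osc Q g = (LINT y:Q|lebesgue. norm (g y - Avg Q g)) / measure lebesgue Q"

lemma mean_osc_eq_osc:
  assumes "locally_integrable g" "Q \<in> cubes"
  shows "mean_osc Q g = ennreal (osc Q g)"
proof -
  have "(\<integral>\<^sup>+ y\<in>Q. ennreal (norm (g y - Avg Q g)) \<partial>lebesgue)
      = (\<integral>\<^sup>+ y. ennreal (indicator Q y *\<^sub>R norm (g y - Avg Q g)) \<partial>lebesgue)"
    by (intro nn_integral_cong) (simp split: split_indicator)
  also have "\<dots> = ennreal (LINT y:Q|lebesgue. norm (g y - Avg Q g))"
    unfolding set_lebesgue_integral_def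
    using set_integrable_dist_cubes[OF assms]
    by (intro nn_integral_eq_integral) (auto simp: set_integrable_def)
  finally show ?thesis
    using assms(2) unfolding mean_osc_def osc_def
    by (simp add: emeasure_cubes measure_cubes_pos divide_ennreal set_lebesgue_integral_def)
qed

text \<open>Continuity from above gives convergence of the measures and averages, and dominated
  convergence then handles the oscillation integral. That the intersection is again a cube keeps the
  limiting measure positive, so the quotients converge.\<close>

lemma osc_tendsto_decseq:
  assumes g: "locally_integrable g" and Q: "\<And>k. Q k \<in> cubes" and "decseq Q"
    and R: "(\<Inter>k. Q k) \<in> cubes"
  shows "(\<lambda>k. osc (Q k) g) \<longlonglongrightarrow> osc (\<Inter>k. Q k) g"
proof -
  define R where "R = (\<Inter>k. Q k)"
  \<comment> \<open>Polymorphic in the codomain: applied to the real constant 1 for the measures and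
    to \<open>g\<close> for the averages.\<close>
  have cont: "(\<lambda>k. LINT y:Q k|lebesgue. h y) \<longlonglongrightarrow> (LINT y:R|lebesgue. h y)"
    if "set_integrable lebesgue (Q 0) h"
    for h :: "real^'a \<Rightarrow> 'b::{banach,second_countable_topology}"
    unfolding R_def using Q \<open>decseq Q\<close> that
    by (intro set_integral_cont_down) (auto simp: sets_cubes)
  have meas: "(\<lambda>k. measure lebesgue (Q k)) \<longlonglongrightarrow> measure lebesgue R"
    using cont[of "\<lambda>_. 1::real"] set_integrable_const_cubes[OF Q, of 0 "1::real"] Q R
    by (simp add: set_lebesgue_integral_def sets_cubes R_def)
  have avg: "(\<lambda>k. Avg (Q k) g) \<longlonglongrightarrow> Avg R g"
    unfolding Avg_def using measure_cubes_pos[OF R]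
    by (intro tendsto_intros meas cont locally_integrable_cubes g Q) (simp add: R_def)
  \<comment> \<open>A uniform bound on the averages supplies the integrable majorant
    \<open>norm (g y) + B\<close> on \<open>Q 0\<close>.\<close>
  obtain B where B: "\<And>k. norm (Avg (Q k) g) \<le> B"
    using convergent_imp_bounded[OF avg] by (auto simp: bounded_iff)
  have "(\<lambda>k. LINT y:Q k|lebesgue. norm (g y - Avg (Q k) g))
      \<longlonglongrightarrow> (LINT y:R|lebesgue. norm (g y - Avg R g))"
    unfolding set_lebesgue_integral_def
  proof (rule integral_dominated_convergence[where w = "\<lambda>y. indicator (Q 0) y *\<^sub>R (norm (g y) + B)"])
    show "integrable lebesgue (\<lambda>y. indicator (Q 0) y *\<^sub>R (norm (g y) + B))"
      unfolding set_integrable_def[symmetric]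
      by (intro set_integral_add set_integrable_norm locally_integrable_cubes set_integrable_const_cubes g Q)
    show "(\<lambda>y. indicator R y *\<^sub>R norm (g y - Avg R g)) \<in> borel_measurable lebesgue"
      using set_integrable_dist_cubes[OF g R] unfolding R_def set_integrable_def
      by (rule borel_measurable_integrable)
    show "(\<lambda>y. indicator (Q k) y *\<^sub>R norm (g y - Avg (Q k) g)) \<in> borel_measurable lebesgue" for k
      using set_integrable_dist_cubes[OF g Q] unfolding set_integrable_def
      by (rule borel_measurable_integrable)
    show "AE y in lebesgue. (\<lambda>k. indicator (Q k) y *\<^sub>R norm (g y - Avg (Q k) g))
        \<longlonglongrightarrow> indicator R y *\<^sub>R norm (g y - Avg R g)"
      unfolding R_def
      by (intro AE_I2 tendsto_intros LIMSEQ_indicator_decseq \<open>decseq Q\<close> avg[unfolded R_def])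
    show "AE y in lebesgue. norm (indicator (Q k) y *\<^sub>R norm (g y - Avg (Q k) g))
        \<le> indicator (Q 0) y *\<^sub>R (norm (g y) + B)" for k
    proof (intro AE_I2)
      fix y
      have "Q k \<subseteq> Q 0"
        using \<open>decseq Q\<close> by (simp add: decseqD)
      moreover have "norm (g y - Avg (Q k) g) \<le> norm (g y) + B"
        using norm_triangle_ineq4[of "g y" "Avg (Q k) g"] B[of k] by linarith
      ultimately show "norm (indicator (Q k) y *\<^sub>R norm (g y - Avg (Q k) g))
          \<le> indicator (Q 0) y *\<^sub>R (norm (g y) + B)"
        \<comment> \<open>On \<open>Q 0\<close> outside \<open>Q k\<close> the left side vanishes,
          so the bound there rests on \<open>0 \<le> B\<close>.\<close>
        using order_trans[OF norm_ge_zero B] by (auto split: split_indicator)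
    qed
  qed
  then show ?thesis
    unfolding osc_def R_def[symmetric]
    using measure_cubes_pos[OF R] by (intro tendsto_divide meas) (auto simp: R_def)
qed

text \<open>A closed cube is the decreasing intersection of slightly larger concentric cubes, so
  their mean oscillations converge to that of \<open>Q\<close> and a strict lower bound survives for
  one of them.\<close>

lemma cube_enlargement:
  assumes g: "locally_integrable g" and Q: "Q \<in> cubes" and t: "t < mean_osc Q g"
  obtains Q' where "Q' \<in> cubes" "Q \<subseteq> interior Q'" "t < mean_osc Q' g"
proof -
  obtain a :: "real^'a" and l where l: "0 < l" and Qeq: "Q = cbox a (a + (\<chi> i. l))"
    using Q by (auto simp: cubes_def)
  define r where "r k = inverse (real (Suc k))" for k
  \<comment> \<open>Moving the corner by \<open>r k\<close> and lengthening the side by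
    \<open>2 * r k\<close> keeps the centre of \<open>Q\<close>, with margin \<open>r k\<close> on
    every face.\<close>
  define P where "P k = cbox (a - (\<chi> i. r k)) (a - (\<chi> i. r k) + (\<chi> i. l + 2 * r k))" for k
  have r0: "0 < r k" for k
    by (simp add: r_def)
  have P: "P k \<in> cubes" for k
    unfolding cubes_def P_def using l r0[of k] by force
  have mem: "x \<in> P k \<longleftrightarrow> (\<forall>i. a $ i - r k \<le> x $ i \<and> x $ i \<le> a $ i + l + r k)" for x k
    by (auto simp: P_def mem_box_cart algebra_simps)
  have memQ: "x \<in> Q \<longleftrightarrow> (\<forall>i. a $ i \<le> x $ i \<and> x $ i \<le> a $ i + l)" for x
    by (auto simp: Qeq mem_box_cart)
  have "decseq P"
    unfolding decseq_Suc_iff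
  proof (intro allI subsetI)
    fix k x assume "x \<in> P (Suc k)"
    moreover have "r (Suc k) \<le> r k"
      by (simp add: r_def field_simps)
    ultimately show "x \<in> P k"
      unfolding mem by (meson add_left_mono diff_left_mono order_trans)
  qed
  have r_lim: "r \<longlonglongrightarrow> 0"
    unfolding r_def by (rule LIMSEQ_inverse_real_of_nat)
  have inter: "(\<Inter>k. P k) = Q"
  proof (intro set_eqI iffI)
    fix x assume x: "x \<in> (\<Inter>k. P k)"
    have "a $ i - 0 \<le> x $ i" for i
      using x by (intro LIMSEQ_le_const2[OF tendsto_diff[OF tendsto_const r_lim]]) (auto simp: mem)
    moreover have "x $ i \<le> a $ i + l + 0" for i
      using x by (intro LIMSEQ_le_const[OF tendsto_add[OF tendsto_const r_lim]]) (auto simp: mem)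
    ultimately show "x \<in> Q"
      by (simp add: memQ)
  next
    fix x assume x: "x \<in> Q"
    show "x \<in> (\<Inter>k. P k)"
    proof
      fix k show "x \<in> P k"
        unfolding mem
      proof
        fix i show "a $ i - r k \<le> x $ i \<and> x $ i \<le> a $ i + l + r k"
          using x[unfolded memQ, rule_format, of i] r0[of k] by linarith
      qed
    qed
  qed
  have "(\<lambda>k. mean_osc (P k) g) \<longlonglongrightarrow> mean_osc Q g"
    using osc_tendsto_decseq[OF g P \<open>decseq P\<close>] Q P
    by (auto simp: mean_osc_eq_osc g inter intro: tendsto_ennrealI)
  then have "\<forall>\<^sub>F k in sequentially. t < mean_osc (P k) g"
    using t by (rule order_tendstoD)
  then obtain k where k: "t < mean_osc (P k) g"
    by (auto simp: eventually_sequentially)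
  have "Q \<subseteq> interior (P k)"
  proof
    fix x assume x: "x \<in> Q"
    show "x \<in> interior (P k)"
      unfolding P_def interior_cbox mem_box_cart
    proof
      fix i
      show "(a - (\<chi> i. r k)) $ i < x $ i \<and> x $ i < (a - (\<chi> i. r k) + (\<chi> i. l + 2 * r k)) $ i"
        using x[unfolded memQ, rule_format, of i] r0[of k] by simp
    qed
  qed
  with P k show thesis
    using that by blast
qed

text \<open>This is lower semicontinuity: a cube witnessing the inequality at \<open>x\<close> can
  be enlarged to one that witnesses it on a whole neighbourhood of \<open>x\<close>.\<close>

lemma open_sharp_max_greater:
  assumes "locally_integrable g"
  shows "open {x. t < sharp_max g x}"
  unfolding open_subopen[of "{x. t < sharp_max g x}"]
proof
  fix x assume "x \<in> {x. t < sharp_max g x}"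
  then obtain Q where Q: "Q \<in> cubes" "x \<in> Q" "t < mean_osc Q g"
    by (auto simp: sharp_max_def less_SUP_iff)
  obtain Q' where "Q' \<in> cubes" "Q \<subseteq> interior Q'" "t < mean_osc Q' g"
    using cube_enlargement[OF assms Q(1,3)] .
  then have "interior Q' \<subseteq> {x. t < sharp_max g x}"
    using interior_subset by (fastforce simp: sharp_max_def less_SUP_iff)
  with \<open>x \<in> Q\<close> \<open>Q \<subseteq> interior Q'\<close>
  show "\<exists>T. open T \<and> x \<in> T \<and> T \<subseteq> {x. t < sharp_max g x}"
    by blast
qed

lemma borel_measurable_sharp_max:
  assumes "locally_integrable g"
  shows "sharp_max g \<in> borel_measurable lebesgue"
  using open_sharp_max_greater[OF assms]
  by (intro borel_measurableI_greater) (auto intro!: borel_open sets_completionI_sets)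

text \<open>Every cube has positive measure and hence a point, so its oscillation is counted in the
  supremum at that point.\<close>

lemma SUP_sharp_max: "(SUP x. sharp_max g x) = bmo_norm g"
proof (rule antisym)
  show "(SUP x. sharp_max g x) \<le> bmo_norm g"
    unfolding sharp_max_def bmo_norm_def by (intro SUP_least SUP_subset_mono) auto
  show "bmo_norm g \<le> (SUP x. sharp_max g x)"
    unfolding bmo_norm_def
  proof (rule SUP_least)
    fix Q :: "(real^'a) set" assume Q: "Q \<in> cubes"
    then obtain x where "x \<in> Q"
      using measure_cubes_pos[of Q] by fastforce
    then have "mean_osc Q g \<le> sharp_max g x"
      unfolding sharp_max_def using Q by (intro SUP_upper) auto
    also have "\<dots> \<le> (SUP x. sharp_max g x)"
      by (intro SUP_upper) auto
    finally show "mean_osc Q g \<le> (SUP x. sharp_max g x)" .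
  qed
qed

text \<open>The set where the function exceeds its essential supremum is null, and by lower
  semicontinuity it is open. A nonempty open set has positive measure, so the set is empty.\<close>

lemma esssup_sharp_max:
  fixes g :: "real^'n::finite \<Rightarrow> complex"
  assumes "locally_integrable g"
  shows "esssup lebesgue (sharp_max g) = bmo_norm g"
proof (rule antisym)
  show "esssup lebesgue (sharp_max g) \<le> bmo_norm g"
    unfolding SUP_sharp_max[symmetric]
    by (intro esssup_I borel_measurable_sharp_max assms AE_I2 SUP_upper) auto
  let ?U = "{x. esssup lebesgue (sharp_max g) < sharp_max g x}"
  have "emeasure lebesgue ?U = 0"
    using esssup_zero_measure[of lebesgue "sharp_max g"] by simp
  then have "?U \<in> null_sets lebesgue"
    using open_sharp_max_greater[OF assms] by (auto intro!: null_setsI borel_open sets_completionI_sets)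
  then have "?U = {}"
    using open_sharp_max_greater[OF assms] open_not_negligible[of ?U] negligible_iff_null_sets[of ?U]
    by blast
  then show "bmo_norm g \<le> esssup lebesgue (sharp_max g)"
    unfolding SUP_sharp_max[symmetric] by (intro SUP_least) (auto simp: not_less)
qed

section \<open>Growth of BMO functions\<close>

text \<open>The truncations to balls of radius \<open>k\<close> are integrable, hence measurable,
  and at each point they are eventually equal to \<open>f\<close>.\<close>

lemma borel_measurable_locally_integrable:
  fixes f :: "real^'n::finite \<Rightarrow> complex"
  assumes "locally_integrable f"
  shows "f \<in> borel_measurable lebesgue"
proof (rule borel_measurable_LIMSEQ_metric)
  show "(\<lambda>x. indicator (cball 0 (real k)) x *\<^sub>R f x) \<in> borel_measurable lebesgue" for k
    using assms compact_cball unfolding locally_integrable_def set_integrable_def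
    by (blast intro: borel_measurable_integrable)
  fix x :: "real^'n"
  obtain k0 :: nat where k0: "norm x \<le> real k0"
    using real_arch_simple by blast
  have "indicator (cball 0 (real k)) x *\<^sub>R f x = f x" if "k0 \<le> k" for k
    using that k0 by (auto simp: indicator_def)
  then have "\<forall>\<^sub>F k in sequentially. indicator (cball 0 (real k)) x *\<^sub>R f x = f x"
    unfolding eventually_sequentially by blast
  then show "(\<lambda>k. indicator (cball 0 (real k)) x *\<^sub>R f x) \<longlonglongrightarrow> f x"
    by (rule tendsto_eventually)
qed

section \<open>Multiplication by the unimodular chirp\<close>

lemma norm_chirp: "norm (chirp \<alpha> f x) = norm (f x)"
  by (simp add: chirp_def norm_mult)

lemma locally_integrable_chirp:
  fixes f :: "real^'n::finite \<Rightarrow> complex"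
  assumes "locally_integrable f"
  shows "locally_integrable (chirp \<alpha> f)"
  unfolding locally_integrable_def
proof (intro allI impI)
  fix K :: "(real^'n) set" assume K: "compact K"
  have "(\<lambda>x::real^'n. exp (\<i> * of_real (pi * (norm x)\<^sup>2 * cot \<alpha>))) \<in> borel_measurable lebesgue"
    by (intro measurable_completion borel_measurable_continuous_onI continuous_intros)
      (simp add: borel_measurable_continuous_onI)
  then have "chirp \<alpha> f \<in> borel_measurable lebesgue"
    unfolding chirp_def
    using borel_measurable_locally_integrable[OF assms] by (intro borel_measurable_times)
  then have "set_borel_measurable lebesgue K (chirp \<alpha> f)"
    unfolding set_borel_measurable_def
    using fmeasurableD[OF lmeasurable_compact[OF K]]
    by (intro borel_measurable_scaleR borel_measurable_indicator)
  then show "set_integrable lebesgue K (chirp \<alpha> f)"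
    using assms K
    by (intro set_integrable_bound[where f = f and g = "chirp \<alpha> f"]) (auto simp: locally_integrable_def norm_chirp)
qed

section \<open>Dyadic cubes about the origin and the growth of averages over them\<close>

definition dyadic :: "nat \<Rightarrow> (real^'n::finite) set" where
  "dyadic k = cbox (\<chi> i. - (2 ^ k)) (\<chi> i. 2 ^ k)"

text \<open>Corner-plus-side form, as in \<open>cubes\<close>; the side \<open>2 ^ Suc k\<close> is
  twice the half-width.\<close>

lemma dyadic_alt:
  "dyadic k = cbox (\<chi> i. - (2 ^ k)) ((\<chi> i. - (2 ^ k)) + (\<chi> i. 2 ^ Suc k) :: real^'n::finite)"
  unfolding dyadic_def by (rule arg_cong[where f = "cbox _"]) (simp add: vec_eq_iff)

lemma dyadic_in_cubes: "dyadic k \<in> cubes"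
proof -
  have "0 < (2::real) ^ Suc k"
    by simp
  then show ?thesis
    unfolding cubes_def dyadic_alt by blast
qed

lemma measure_dyadic: "measure lebesgue (dyadic k :: (real^'n::finite) set) = 2 ^ (Suc k * CARD('n))"
  unfolding dyadic_alt power_mult by (rule measure_cube) simp

lemma mem_dyadic: "x \<in> dyadic k \<longleftrightarrow> (\<forall>i. \<bar>x $ i\<bar> \<le> 2 ^ k)"
  by (auto simp: dyadic_def mem_box_cart abs_le_iff minus_le_iff)

lemma dyadic_Suc: "dyadic k \<subseteq> dyadic (Suc k)"
proof -
  have "(2::real) ^ k \<le> 2 ^ Suc k"
    by simp
  then show ?thesis
    unfolding subset_iff mem_dyadic by (meson order_trans)
qed

lemma norm_le_mem_dyadic: "norm x \<le> 2 ^ k \<Longrightarrow> x \<in> dyadic k"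
  by (meson mem_dyadic component_le_norm_cart order_trans)

text \<open>Since \<open>enn2real\<close> sends infinity to 0, the real form of the BMO bound relies
  on the norm being finite.\<close>

lemma integral_dist_le_bmo_norm:
  assumes g: "locally_integrable g" "bmo_norm g < \<infinity>" and Q: "Q \<in> cubes"
  shows "(LINT y:Q|lebesgue. norm (g y - Avg Q g)) \<le> enn2real (bmo_norm g) * measure lebesgue Q"
proof -
  have "ennreal (osc Q g) \<le> bmo_norm g"
    unfolding mean_osc_eq_osc[OF g(1) Q, symmetric] bmo_norm_def using Q by (rule SUP_upper)
  then have "ennreal (osc Q g) \<le> ennreal (enn2real (bmo_norm g))"
    using g(2) by (simp add: ennreal_enn2real less_top)
  then have "osc Q g \<le> enn2real (bmo_norm g)"
    by (simp add: ennreal_le_iff)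
  then show ?thesis
    using measure_cubes_pos[OF Q] unfolding osc_def by (simp add: pos_divide_le_eq)
qed

text \<open>For a constant \<open>c\<close>, \<open>Avg Q g - c\<close> is the average of
  \<open>g - c\<close> over \<open>Q\<close>. With \<open>c = Avg Q' g\<close>, the integral of the
  norm only grows on passing to \<open>Q'\<close>, while the divisor remains the measure of
  \<open>Q\<close>.\<close>

lemma Avg_subset_diff_le:
  assumes g: "locally_integrable g" and Q: "Q \<in> cubes" "Q' \<in> cubes" "Q \<subseteq> Q'"
  shows "norm (Avg Q g - Avg Q' g)
    \<le> (LINT y:Q'|lebesgue. norm (g y - Avg Q' g)) / measure lebesgue Q"
proof -
  let ?c = "Avg Q' g" and ?m = "measure lebesgue Q"
  have m: "0 < ?m"
    by (rule measure_cubes_pos[OF Q(1)])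
  have "(LINT y:Q|lebesgue. g y - ?c) = ?m *\<^sub>R (Avg Q g - ?c)"
    using m set_integral_diff(2)[OF locally_integrable_cubes[OF g Q(1)] set_integrable_const_cubes[OF Q(1), of ?c]]
      set_integral_const_cubes[OF Q(1), of ?c]
    unfolding Avg_def[of Q] by (simp add: scaleR_diff_right)
  then have "?m * norm (Avg Q g - ?c) = norm (LINT y:Q|lebesgue. g y - ?c)"
    using m by simp
  also have "\<dots> \<le> (LINT y:Q|lebesgue. norm (g y - ?c))"
    unfolding set_lebesgue_integral_def
    by (rule order_trans[OF integral_norm_bound]) (simp add: abs_indicator)
  also have "\<dots> \<le> (LINT y:Q'|lebesgue. norm (g y - ?c))"
    unfolding set_lebesgue_integral_def
    using set_integrable_dist_cubes[OF g Q(1), of ?c] set_integrable_dist_cubes[OF g Q(2), of ?c] Q(3)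
    by (intro integral_mono) (auto simp: set_integrable_def split: split_indicator)
  finally show ?thesis
    using m by (simp add: pos_le_divide_eq mult.commute)
qed

text \<open>Averages over consecutive cubes differ by a bounded amount, so they grow at most
  linearly in \<open>k\<close>. Bounding \<open>k\<close> by \<open>2 ^ k\<close> costs one power of
  \<open>2 ^ k\<close> beyond the measure, hence the exponent \<open>Suc CARD('n)\<close>.\<close>

lemma bmo_integral_dyadic_le:
  fixes g :: "real^'n::finite \<Rightarrow> complex"
  assumes g: "locally_integrable g" "bmo_norm g < \<infinity>"
  obtains B where "0 \<le> B"
    "\<And>k. (LINT y:dyadic k|lebesgue. norm (g y)) \<le> B * (2 ^ Suc CARD('n)) ^ k"
proof -
  define M where "M = enn2real (bmo_norm g)"
  define A where "A k = norm (Avg (dyadic k) g)" for k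
  define n where "n = CARD('n)"
  have M: "0 \<le> M"
    by (simp add: M_def)
  have A0: "0 \<le> A 0"
    by (simp add: A_def)
  \<comment> \<open>The factor \<open>2 ^ n\<close> is the ratio of the measures of two consecutive
    dyadic cubes.\<close>
  have step: "A (Suc k) \<le> A k + 2 ^ n * M" for k
  proof -
    have "norm (Avg (dyadic k) g - Avg (dyadic (Suc k)) g)
        \<le> M * measure lebesgue (dyadic (Suc k) :: (real^'n) set) / measure lebesgue (dyadic k :: (real^'n) set)"
      unfolding M_def
      by (intro order_trans[OF Avg_subset_diff_le[OF g(1) dyadic_in_cubes dyadic_in_cubes dyadic_Suc]]
          divide_right_mono integral_dist_le_bmo_norm g dyadic_in_cubes measure_nonneg)
    also have "\<dots> = 2 ^ n * M"
      unfolding measure_dyadic n_def by (simp add: power_add field_simps)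
    finally show ?thesis
      unfolding A_def
      using norm_triangle_ineq2[of "Avg (dyadic (Suc k)) g" "Avg (dyadic k) g"]
      by (simp add: norm_minus_commute)
  qed
  have A: "A k \<le> A 0 + real k * (2 ^ n * M)" for k
  proof (induction k)
    case (Suc k)
    then show ?case
      using step[of k] by (simp add: algebra_simps)
  qed simp
  \<comment> \<open>The outer \<open>2 ^ n\<close> comes from the side \<open>2 ^ Suc k\<close>
    instead of \<open>2 ^ k\<close>. The summands account for the oscillation, the initial average
    and the increments of the averages.\<close>
  define B where "B = 2 ^ n * (M + A 0 + 2 ^ n * M)"
  have "(LINT y:dyadic k|lebesgue. norm (g y)) \<le> B * (2 ^ Suc CARD('n)) ^ k" for k
  proof -
    let ?Q = "dyadic k :: (real^'n) set" and ?c = "Avg (dyadic k) g"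
    have Q: "?Q \<in> cubes"
      by (rule dyadic_in_cubes)
    have "(LINT y:?Q|lebesgue. norm (g y)) \<le> (LINT y:?Q|lebesgue. norm (g y - ?c) + A k)"
    proof (rule set_integral_mono)
      show "set_integrable lebesgue ?Q (\<lambda>y. norm (g y))"
        by (intro set_integrable_norm locally_integrable_cubes g Q)
      show "set_integrable lebesgue ?Q (\<lambda>y. norm (g y - ?c) + A k)"
        by (intro set_integral_add set_integrable_dist_cubes set_integrable_const_cubes g Q)
      show "norm (g y) \<le> norm (g y - ?c) + A k" for y
        unfolding A_def using norm_triangle_ineq2[of "g y" ?c] by simp
    qed
    also have "\<dots> = (LINT y:?Q|lebesgue. norm (g y - ?c)) + (LINT y:?Q|lebesgue. A k)"
      by (intro set_integral_add set_integrable_dist_cubes set_integrable_const_cubes g Q)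
    also have "(LINT y:?Q|lebesgue. A k) = A k * measure lebesgue ?Q"
      by (simp add: set_integral_const_cubes[OF Q] mult.commute del: measure_completion)
    also have "(LINT y:?Q|lebesgue. norm (g y - ?c)) + A k * measure lebesgue ?Q
        \<le> (M + A k) * measure lebesgue ?Q"
      using integral_dist_le_bmo_norm[OF g Q] by (simp add: M_def algebra_simps)
    also have "\<dots> \<le> (2 ^ k * (M + A 0 + 2 ^ n * M)) * measure lebesgue ?Q"
    proof (intro mult_right_mono measure_nonneg)
      have "1 \<le> (2::real) ^ k" "real k \<le> 2 ^ k"
        using of_nat_less_two_power[of k, where 'a = real] by (auto intro: less_imp_le)
      then have "M * 1 \<le> M * 2 ^ k" "A 0 * 1 \<le> A 0 * 2 ^ k"
        "real k * (2 ^ n * M) \<le> 2 ^ k * (2 ^ n * M)"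
        using M A0 by (intro mult_left_mono mult_right_mono; simp)+
      then show "M + A k \<le> 2 ^ k * (M + A 0 + 2 ^ n * M)"
        using A[of k] by (simp add: algebra_simps)
    qed
    also have "\<dots> = B * (2 ^ Suc CARD('n)) ^ k"
      unfolding measure_dyadic B_def n_def
      by (simp add: power_add power_mult power_mult_distrib mult.commute[of k] flip: power_mult)
    finally show ?thesis .
  qed
  moreover have "0 \<le> B"
    using M A0 by (simp add: B_def)
  ultimately show thesis
    using that by blast
qed

text \<open>Where \<open>dyadic k\<close> is the first dyadic cube to contain \<open>x\<close>, the
  weight is at most a constant times \<open>1 / (2 ^ Suc p) ^ k\<close>. Against integrals of size
  \<open>(2 ^ p) ^ k\<close> this leaves a geometric series of ratio 1/2.\<close>

lemma integrable_polynomial_weight: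
  fixes g :: "real^'n::finite \<Rightarrow> complex"
  assumes g: "locally_integrable g" and B: "0 \<le> B"
    and le: "\<And>k. (LINT y:dyadic k|lebesgue. norm (g y)) \<le> B * (2 ^ p) ^ k"
  shows "integrable lebesgue (\<lambda>x. norm (g x) / (1 + norm x) ^ Suc p)"
proof (rule integrableI_bounded)
  define w where "w x = 1 / (1 + norm x) ^ Suc p" for x :: "real^'n"
  \<comment> \<open>The numerator \<open>2 ^ Suc p\<close> absorbs the factor 2 in
    \<open>2 ^ k \<le> 2 * (1 + norm x)\<close>. Full cubes serve instead of disjoint shells, since
    only an upper bound is sought.\<close>
  define h where "h k x = ennreal (2 ^ Suc p / (2 ^ Suc p) ^ k) * ennreal (indicator (dyadic k) x *\<^sub>R norm (g x))"
    for k and x :: "real^'n"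
  have int: "integrable lebesgue (\<lambda>x. indicator (dyadic k) x *\<^sub>R norm (g x))" for k
    using set_integrable_norm[OF locally_integrable_cubes[OF g dyadic_in_cubes[of k]]]
    by (simp add: set_integrable_def)
  have meas: "h k \<in> borel_measurable lebesgue" for k
    unfolding h_def using int by measurable
  have "(\<lambda>x::real^'n. (1 + norm x) ^ Suc p) \<in> borel_measurable lebesgue"
    by (intro measurable_completion borel_measurable_continuous_onI continuous_intros)
      (simp add: borel_measurable_continuous_onI)
  then show "(\<lambda>x. norm (g x) / (1 + norm x) ^ Suc p) \<in> borel_measurable lebesgue"
    using borel_measurable_locally_integrable[OF g] by measurable
  have pt: "ennreal (norm (norm (g x) / (1 + norm x) ^ Suc p)) \<le> (\<Sum>k. h k x)" for x
  proof -
    obtain m :: nat where "norm x < 2 ^ m"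
      using real_arch_pow[of 2 "norm x"] by auto
    then have ex: "\<exists>k. x \<in> dyadic k"
      using norm_le_mem_dyadic less_imp_le by blast
    define k where "k = (LEAST k. x \<in> dyadic k)"
    have k: "x \<in> dyadic k"
      unfolding k_def using ex by (rule LeastI_ex)
    \<comment> \<open>By minimality of \<open>k\<close>, the point lies outside the previous cube
      and so has norm above half of \<open>2 ^ k\<close>; for \<open>k = 0\<close> the summand 1
      suffices.\<close>
    have "2 ^ k \<le> 2 * (1 + norm x)"
    proof (cases k)
      case (Suc j)
      then have "x \<notin> dyadic j"
        using not_less_Least[of j "\<lambda>k. x \<in> dyadic k"] by (simp add: k_def)
      then have "2 ^ j < norm x"
        using norm_le_mem_dyadic not_less by blast
      then show ?thesis
        by (simp add: Suc)
    qed simp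
    then have "(2 ^ k) ^ Suc p \<le> (2 * (1 + norm x)) ^ Suc p"
      by (intro power_mono) auto
    then have "(2 ^ Suc p) ^ k \<le> 2 ^ Suc p * (1 + norm x) ^ Suc p"
      by (simp only: power_mult_distrib power_mult[symmetric] mult.commute[of k])
    then have "1 / (1 + norm x) ^ Suc p \<le> 2 ^ Suc p / (2 ^ Suc p) ^ k"
      using zero_less_power[of "1 + norm x" "Suc p"]
      by (simp add: frac_le_eq pos_divide_le_eq pos_le_divide_eq add_pos_nonneg mult.commute del: power_Suc)
    then have "norm (norm (g x) / (1 + norm x) ^ Suc p) \<le> 2 ^ Suc p / (2 ^ Suc p) ^ k * norm (g x)"
      using mult_right_mono[of "1 / (1 + norm x) ^ Suc p" "2 ^ Suc p / (2 ^ Suc p) ^ k" "norm (g x)"]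
      by (simp add: power_abs)
    then have "ennreal (norm (norm (g x) / (1 + norm x) ^ Suc p)) \<le> h k x"
      unfolding h_def using k by (simp add: ennreal_leI del: power_Suc flip: ennreal_mult)
    also have "\<dots> \<le> (\<Sum>k. h k x)"
      using sum_le_suminf[of "\<lambda>k. h k x" "{k}"] by simp
    finally show ?thesis .
  qed
  have "(\<integral>\<^sup>+ x. h k x \<partial>lebesgue) \<le> ennreal (2 ^ Suc p * B * (1 / 2) ^ k)" for k
  proof -
    have "(\<integral>\<^sup>+ x. h k x \<partial>lebesgue)
        = ennreal (2 ^ Suc p / (2 ^ Suc p) ^ k) * ennreal (LINT y:dyadic k|lebesgue. norm (g y))"
      unfolding h_def set_lebesgue_integral_def using int[of k]
      by (subst nn_integral_cmult) (auto simp: nn_integral_eq_integral)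
    also have "\<dots> = ennreal (2 ^ Suc p / (2 ^ Suc p) ^ k * (LINT y:dyadic k|lebesgue. norm (g y)))"
      by (rule ennreal_mult'[symmetric]) simp
    also have "\<dots> \<le> ennreal (2 ^ Suc p / (2 ^ Suc p) ^ k * (B * (2 ^ p) ^ k))"
      by (intro ennreal_leI mult_left_mono le) simp
    also have "2 ^ Suc p / (2 ^ Suc p) ^ k * (B * (2 ^ p) ^ k) = 2 ^ Suc p * B * (1 / 2) ^ k"
      by (simp add: power_mult_distrib power_divide)
    finally show ?thesis .
  qed
  then have "(\<Sum>k. \<integral>\<^sup>+ x. h k x \<partial>lebesgue) \<le> (\<Sum>k. ennreal (2 ^ Suc p * B * (1 / 2) ^ k))"
    by (intro suminf_le) auto
  also have "\<dots> < \<infinity>"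
    using B summable_mult[OF summable_geometric[of "1/2::real"], of "2 ^ Suc p * B"]
    by (subst suminf_ennreal2) auto
  finally have fin: "(\<Sum>k. \<integral>\<^sup>+ x. h k x \<partial>lebesgue) < \<infinity>" .
  have "(\<integral>\<^sup>+ x. ennreal (norm (norm (g x) / (1 + norm x) ^ Suc p)) \<partial>lebesgue)
      \<le> (\<integral>\<^sup>+ x. (\<Sum>k. h k x) \<partial>lebesgue)"
    by (intro nn_integral_mono pt)
  also have "\<dots> = (\<Sum>k. \<integral>\<^sup>+ x. h k x \<partial>lebesgue)"
    by (intro nn_integral_suminf meas)
  finally show "(\<integral>\<^sup>+ x. ennreal (norm (norm (g x) / (1 + norm x) ^ Suc p)) \<partial>lebesgue) < \<infinity>"
    using fin by (rule order_le_less_trans)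
qed

section \<open>Pairing with Schwartz functions\<close>

lemma schwartz_le_schwartz_norm:
  assumes "\<phi> \<in> schwartz"
  shows "(1 + norm x) ^ N * norm (\<phi> x) \<le> schwartz_norm N \<phi>"
proof -
  have fin: "finite {\<beta> :: 'a list. length \<beta> \<le> N}"
    using finite_lists_length_le[of "UNIV :: 'a set" N] by simp
  let ?h = "\<lambda>(\<beta>, x). (1 + norm x) ^ N * norm (partials \<beta> \<phi> x)"
  have "?h ` ({\<beta>. length \<beta> \<le> N} \<times> UNIV) =
      (\<Union>\<beta>\<in>{\<beta>. length \<beta> \<le> N}. range (\<lambda>x. (1 + norm x) ^ N * norm (partials \<beta> \<phi> x)))"
    by fastforce
  \<comment> \<open>A supremum of reals is an upper bound only if the set is bounded; here it is a
    finite union of bounded ranges.\<close>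
  also have "bdd_above \<dots>"
    using assms fin by (auto simp: schwartz_def)
  \<comment> \<open>The empty list of derivatives stands for \<phi> itself.\<close>
  finally have "?h ([], x) \<le> schwartz_norm N \<phi>"
    unfolding schwartz_norm_def by (intro cSUP_upper) auto
  then show ?thesis
    by simp
qed

lemma borel_measurable_schwartz:
  assumes "\<phi> \<in> schwartz"
  shows "\<phi> \<in> borel_measurable lebesgue"
proof -
  have "\<phi> differentiable (at x)" for x
    using assms unfolding schwartz_def smooth_def by (metis (mono_tags, lifting) mem_Collect_eq partials.simps(1))
  then have "continuous_on UNIV \<phi>"
    by (simp add: continuous_on_eq_continuous_at differentiable_imp_continuous_within)
  then show ?thesis
    by (intro measurable_completion) (simp add: borel_measurable_continuous_onI)
qed

text \<open>Multiplying and dividing by \<open>(1 + norm x) ^ N\<close> splits the integrand into a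
  factor bounded by \<open>schwartz_norm N \<phi>\<close> and an integrable one. Integration against
  \<open>f\<close> is thus continuous on the whole Schwartz space.\<close>

lemma tempered_function_polynomial_weight:
  fixes f :: "real^'n::finite \<Rightarrow> complex"
  assumes f: "locally_integrable f"
    and int: "integrable lebesgue (\<lambda>x. norm (f x) / (1 + norm x) ^ N)"
  shows "tempered_function f"
proof -
  define C where "C = (LINT x|lebesgue. norm (f x) / (1 + norm x) ^ N)"
  define T where "T \<phi> = (LINT x|lebesgue. f x * \<phi> x)" for \<phi>
  have bound: "norm (f x * \<phi> x) \<le> schwartz_norm N \<phi> * (norm (f x) / (1 + norm x) ^ N)"
    if "\<phi> \<in> schwartz" for \<phi> x
  proof -
    have pos: "0 < (1 + norm x) ^ N"
      by (intro zero_less_power) (simp add: add_pos_nonneg)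
    have "norm (f x * \<phi> x) = (1 + norm x) ^ N * norm (\<phi> x) * (norm (f x) / (1 + norm x) ^ N)"
      using pos less_imp_neq[OF pos] by (simp add: norm_mult del: power_eq_0_iff)
    also have "\<dots> \<le> schwartz_norm N \<phi> * (norm (f x) / (1 + norm x) ^ N)"
      using pos by (intro mult_right_mono schwartz_le_schwartz_norm that) auto
    finally show ?thesis .
  qed
  have integ: "integrable lebesgue (\<lambda>x. f x * \<phi> x)" if "\<phi> \<in> schwartz" for \<phi>
  proof (rule Bochner_Integration.integrable_bound)
    show "integrable lebesgue (\<lambda>x. schwartz_norm N \<phi> * (norm (f x) / (1 + norm x) ^ N))"
      using int by (rule integrable_mult_right)
    show "(\<lambda>x. f x * \<phi> x) \<in> borel_measurable lebesgue"
      by (intro borel_measurable_times borel_measurable_locally_integrable f borel_measurable_schwartz that)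
    show "AE x in lebesgue. norm (f x * \<phi> x) \<le> norm (schwartz_norm N \<phi> * (norm (f x) / (1 + norm x) ^ N))"
      using bound[OF that] by (intro AE_I2) (metis abs_ge_self order_trans real_norm_def)
  qed
  have lin: "T (\<lambda>x. a * \<phi> x + b * \<psi> x) = a * T \<phi> + b * T \<psi>"
    if "\<phi> \<in> schwartz" "\<psi> \<in> schwartz" for \<phi> \<psi> a b
  proof -
    have "T (\<lambda>x. a * \<phi> x + b * \<psi> x) = (LINT x|lebesgue. a * (f x * \<phi> x) + b * (f x * \<psi> x))"
      unfolding T_def by (simp add: algebra_simps)
    also have "\<dots> = a * T \<phi> + b * T \<psi>"
      unfolding T_def using integ[OF that(1)] integ[OF that(2)] by simp
    finally show ?thesis .
  qed
  have "norm (T \<phi>) \<le> C * schwartz_norm N \<phi>" if "\<phi> \<in> schwartz" for \<phi>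
  proof -
    have "norm (T \<phi>) \<le> (LINT x|lebesgue. norm (f x * \<phi> x))"
      unfolding T_def by (rule integral_norm_bound)
    also have "\<dots> \<le> (LINT x|lebesgue. schwartz_norm N \<phi> * (norm (f x) / (1 + norm x) ^ N))"
      by (intro integral_mono integrable_norm integrable_mult_right integ int bound that)
    also have "\<dots> = C * schwartz_norm N \<phi>"
      unfolding C_def by (subst integral_mult_right_zero) (rule mult.commute)
    finally show ?thesis .
  qed
  with lin have "T \<in> tempered_distributions"
    unfolding tempered_distributions_def by blast
  then show ?thesis
    unfolding tempered_function_def using f T_def by blast
qed

text \<open>The growth bound for \<open>chirp \<alpha> f\<close> passes to \<open>f\<close> because
  the moduli agree. In dimension n the bound has \<open>p = n + 1\<close>, so the weight has
  exponent \<open>n + 2\<close>.\<close>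

lemma tempered_function_BMO_chirp:
  fixes f :: "real^'n::finite \<Rightarrow> complex"
  assumes f: "locally_integrable f" and "bmo_norm (chirp \<alpha> f) < \<infinity>"
  shows "tempered_function f"
proof -
  note g = locally_integrable_chirp[OF f, of \<alpha>]
  obtain B where "0 \<le> B"
    "\<And>k. (LINT y:dyadic k|lebesgue. norm (chirp \<alpha> f y)) \<le> B * (2 ^ Suc CARD('n)) ^ k"
    using bmo_integral_dyadic_le[OF g assms(2)] by blast
  from integrable_polynomial_weight[OF g this] show ?thesis
    unfolding norm_chirp by (rule tempered_function_polynomial_weight[OF f])
qed

theorem proposition15p1:
  shows "(\<forall>(\<alpha>::real) (f :: real^'n::finite \<Rightarrow> complex).
            \<alpha> \<notin> range (\<lambda>k::int. of_int k * pi) \<longrightarrow> locally_integrable f \<longrightarrow>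
            (f \<in> BMO_frac \<alpha> \<longleftrightarrow> sharp_max_frac \<alpha> f \<in> L_infinity)) \<and>
         (\<exists>c C :: real. 0 < c \<and> 0 < C \<and>
            (\<forall>(\<alpha>::real) (f :: real^'n::finite \<Rightarrow> complex).
               \<alpha> \<notin> range (\<lambda>k::int. of_int k * pi) \<longrightarrow> locally_integrable f \<longrightarrow>
               ennreal c * bmo_frac_norm \<alpha> f \<le> esssup lebesgue (sharp_max_frac \<alpha> f) \<and>
               esssup lebesgue (sharp_max_frac \<alpha> f) \<le> ennreal C * bmo_frac_norm \<alpha> f))"
proof -
  have eq: "esssup lebesgue (sharp_max_frac \<alpha> f) = bmo_frac_norm \<alpha> f"
    if "locally_integrable f" for \<alpha> and f :: "real^'n \<Rightarrow> complex"
    unfolding sharp_max_frac_def bmo_frac_norm_def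
    by (intro esssup_sharp_max locally_integrable_chirp that)
  have "f \<in> BMO_frac \<alpha> \<longleftrightarrow> sharp_max_frac \<alpha> f \<in> L_infinity"
    if f: "locally_integrable f" for \<alpha> and f :: "real^'n \<Rightarrow> complex"
  proof -
    \<comment> \<open>Temperedness follows from finiteness of the norm, and local integrability of
      the chirped function from that of \<open>f\<close>.\<close>
    have "f \<in> BMO_frac \<alpha> \<longleftrightarrow> bmo_frac_norm \<alpha> f < \<infinity>"
      using tempered_function_BMO_chirp[OF f, of \<alpha>] locally_integrable_chirp[OF f, of \<alpha>]
      unfolding BMO_frac_def BMO_def bmo_frac_norm_def by blast
    \<comment> \<open>The measurability demanded by \<open>L_infinity\<close> comes from lower
      semicontinuity.\<close>
    also have "\<dots> \<longleftrightarrow> sharp_max_frac \<alpha> f \<in> L_infinity"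
      using borel_measurable_sharp_max[OF locally_integrable_chirp[OF f, of \<alpha>]] eq[OF f, of \<alpha>]
      unfolding L_infinity_def sharp_max_frac_def by simp
    finally show ?thesis .
  qed
  moreover have "ennreal 1 * bmo_frac_norm \<alpha> f \<le> esssup lebesgue (sharp_max_frac \<alpha> f) \<and>
      esssup lebesgue (sharp_max_frac \<alpha> f) \<le> ennreal 1 * bmo_frac_norm \<alpha> f"
    if "locally_integrable f" for \<alpha> and f :: "real^'n \<Rightarrow> complex"
    using eq[OF that, of \<alpha>] by simp
  ultimately show ?thesis
    using zero_less_one by blast
qed

end
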